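(* Let $A\in\mathbb{R}^{n\times n}$ be symmetric with spectral decomposition $A=V\Lambda V^T$, where $V=(v_1,\ldots,v_n)$ is orthogonal and $\Lambda=\mathrm{diag}(\lambda_1,\ldots,\lambda_n)$ with $|\lambda_1|>|\lambda_2|>\cdots>|\lambda_n|>0$. Let $b\in\mathbb{R}^n$ satisfy $v_i^Tb\neq 0$ for $i=1,\ldots,n$. Apply MINRES to $Ax=b$ with starting vector $\bar q_1=b/\|b\|$, and let $\bar x^{(k)}$ be its $k$th iterate. Let $\theta_1^{(k)},\ldots,\theta_k^{(k)}$ be the harmonic Ritz values of $A$ with respect to $\mathcal{K}_k(A,b)$, labeled so that $|\theta_1^{(k)}|>|\theta_2^{(k)}|>\cdots>|\theta_k^{(k)}|>0$. Then $$\bar x^{(k)}=\sum_{i=1}^n f_i^{(k)}\,\frac{v_i^Tb}{\lambda_i}\,v_i,\qquad f_i^{(k)}=1-\prod_{j=1}^k\frac{\theta_j^{(k)}-\lambda_i}{\theta_j^{(k)}},\quad i=1,2,\ldots,n.$$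
   Context: $\|\cdot\|$ is the 2-norm. $\mathcal{K}_k(A,b)=\mathrm{span}\{b,Ab,\ldots,A^{k-1}b\}$ is the $k$-dimensional Krylov subspace. The $k$th MINRES iterate $\bar x^{(k)}$ is the minimizer of $\|b-Ax\|$ over $x\in\mathcal{K}_k(A,b)$. The harmonic Ritz values of $A$ with respect to a subspace $\mathcal{K}$ are the numbers $\theta$ for which there is a nonzero $u\in\mathcal{K}$ with $Au-\theta u$ orthogonal to $A\mathcal{K}$. The labeling in the claim presupposes that there are $k$ (finite) harmonic Ritz values with distinct absolute values. *)

theory Defs
  imports "HOL-Analysis.Analysis"
begin

definition diag_matrix :: "real ^ 'n \<Rightarrow> real ^ 'n ^ 'n" where
  "diag_matrix d = (\<chi> i j. if i = j then d $ i else 0)"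

definition krylov :: "real ^ 'n ^ 'n \<Rightarrow> real ^ 'n \<Rightarrow> nat \<Rightarrow> (real ^ 'n) set" where
  "krylov A b k = span {(((*v) A) ^^ j) b |j. j < k}"

(* A description operator: it is meaningful when the minimizer exists and is unique, for
   instance when A is invertible (lemma ex1_minres_iterate). Minimizing over the Krylov space
   itself, without an offset, means that the initial guess is zero. *)
definition minres_iterate :: "real ^ 'n ^ 'n \<Rightarrow> real ^ 'n \<Rightarrow> nat \<Rightarrow> real ^ 'n" where
  "minres_iterate A b k =
     (THE x. is_arg_min (\<lambda>y. norm (b - A *v y)) (\<lambda>y. y \<in> krylov A b k) x)"

(* Only finite harmonic Ritz values are collected. If the compression of A to K is singular,
   there are fewer of them than the dimension of K. *)
definition harmonic_ritz_values :: "real ^ 'n ^ 'n \<Rightarrow> (real ^ 'n) set \<Rightarrow> real set" where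
  "harmonic_ritz_values A K =
     {\<theta>. \<exists>u\<in>K. u \<noteq> 0 \<and> (\<forall>w\<in>K. orthogonal (A *v u - \<theta> *\<^sub>R u) (A *v w))}"

lemma ex1_minres_iterate:
  fixes A :: "real ^ 'n ^ 'n"
  assumes "invertible A"
  shows "\<exists>!x. is_arg_min (\<lambda>y. norm (b - A *v y)) (\<lambda>y. y \<in> krylov A b k) x"
proof -
  let ?K = "krylov A b k" and ?S = "(*v) A ` krylov A b k"
  have sub: "subspace ?S"
    unfolding krylov_def
    by (intro linear_subspace_image subspace_span matrix_vector_mul_linear)
  have inj: "inj ((*v) A)"
    using assms by (metis inj_matrix_vector_mult)
  have min: "is_arg_min (\<lambda>y. norm (b - A *v y)) (\<lambda>y. y \<in> ?K) x \<longleftrightarrow>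
      x \<in> ?K \<and> (\<forall>z\<in>?S. dist b (A *v x) \<le> dist b z)" for x
    by (auto simp: is_arg_min_linorder dist_norm)
  have cl: "closed ?S" and cv: "convex ?S" and ne: "?S \<noteq> {}"
    using sub closed_subspace subspace_imp_convex subspace_0 by blast+
  obtain z where "z \<in> ?S" "\<forall>y\<in>?S. dist b z \<le> dist b y"
    using closest_point_exists[OF cl ne, of b] by blast
  then obtain x where x: "x \<in> ?K" "\<forall>y\<in>?S. dist b (A *v x) \<le> dist b y"
    by blast
  show ?thesis
  proof (rule ex1I[of _ x])
    show "is_arg_min (\<lambda>y. norm (b - A *v y)) (\<lambda>y. y \<in> ?K) x"
      using x min by blast
    fix y assume "is_arg_min (\<lambda>y. norm (b - A *v y)) (\<lambda>y. y \<in> ?K) y"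
    then have y: "y \<in> ?K" "\<forall>z\<in>?S. dist b (A *v y) \<le> dist b z"
      using min by blast+
    have "A *v y = closest_point ?S b" "A *v x = closest_point ?S b"
      using closest_point_unique[OF cv cl] x y by blast+
    then show "y = x"
      using inj by (metis injD)
  qed
qed

end

theory Submission
  imports Defs
begin

text \<open>
  Let \<open>K\<close> be the Krylov subspace, \<open>q(t) = \<Prod>\<^sub>j (1 - t / \<theta>\<^sub>j)\<close>, and \<open>x\<close> the vector on the
  right-hand side of the theorem. In the eigenbasis \<open>x\<close> is \<open>p(A) b\<close> with \<open>p(t) = (1 - q(t)) / t\<close>.
  Since \<open>q(0) = 1\<close>, this \<open>p\<close> is a polynomial of degree less than \<open>k\<close>, so \<open>x \<in> K\<close>
  (\<open>filtered_solution_in_krylov\<close>), and the residual \<open>b - A x\<close> equals \<open>q(A) b\<close>. By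
  \<open>minres_iterate_eqI\<close> it remains to see that \<open>q(A) b\<close> is orthogonal to \<open>A K\<close>.

  Choose harmonic Ritz vectors \<open>u\<^sub>1, \<dots>, u\<^sub>k \<in> K\<close>. Two observations suffice, both resting on the
  symmetry of \<open>A\<close>. The vectors \<open>A u\<^sub>j\<close> are nonzero and, as the \<open>\<theta>\<^sub>j\<close> are distinct, pairwise
  orthogonal (\<open>harmonic_ritz_vectors_orthogonal\<close>); there are \<open>k\<close> of them and \<open>A K\<close> has dimension
  at most \<open>k\<close>, so they span \<open>A K\<close>. And for each \<open>j\<close> a factor can be split off the residual:
  \<open>q(A) b = (A - \<theta>\<^sub>j) g\<close> with \<open>g \<in> K\<close>, so that its inner product with \<open>A u\<^sub>j\<close> is that of
  \<open>(A - \<theta>\<^sub>j) u\<^sub>j\<close> with \<open>A g\<close>, which vanishes by the definition of a harmonic Ritz pair. These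
  combine in \<open>orthogonal_image_if_all_harmonic_factors\<close>.
\<close>

section \<open>Minimal residuals\<close>

lemma inner_symmetric_matrix:
  fixes A :: "real ^ 'n ^ 'n"
  assumes "transpose A = A"
  shows "(A *v x) \<bullet> y = x \<bullet> (A *v y)"
  by (metis assms dot_lmul_matrix transpose_matrix_vector)

text \<open>The normal equations: by Pythagoras, moving from \<open>x\<close> to another point \<open>y\<close> of the subspace adds
  \<open>\<parallel>A (x - y)\<parallel>\<^sup>2\<close> to the squared residual norm.\<close>

lemma minres_iterate_eqI:
  fixes A :: "real ^ 'n ^ 'n"
  assumes "invertible A" and x: "x \<in> krylov A b k"
    and orth: "\<And>w. w \<in> krylov A b k \<Longrightarrow> orthogonal (b - A *v x) (A *v w)"
  shows "minres_iterate A b k = x"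
proof -
  have "norm (b - A *v x) \<le> norm (b - A *v y)" if y: "y \<in> krylov A b k" for y
  proof -
    have "x - y \<in> krylov A b k"
      using x y by (simp add: krylov_def span_diff)
    then have "orthogonal (b - A *v x) (A *v (x - y))"
      by (rule orth)
    then have "(norm ((b - A *v x) + A *v (x - y)))\<^sup>2 =
        (norm (b - A *v x))\<^sup>2 + (norm (A *v (x - y)))\<^sup>2"
      by (rule norm_add_Pythagorean)
    moreover have "(b - A *v x) + A *v (x - y) = b - A *v y"
      by (simp add: matrix_vector_mult_diff_distrib)
    ultimately show ?thesis
      by (metis le_add_same_cancel1 norm_ge_zero power2_le_imp_le zero_le_power2)
  qed
  then have "is_arg_min (\<lambda>y. norm (b - A *v y)) (\<lambda>y. y \<in> krylov A b k) x"
    using x by (simp add: is_arg_min_linorder)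
  then show ?thesis
    unfolding minres_iterate_def by (rule the1_equality[OF ex1_minres_iterate[OF assms(1)]])
qed

section \<open>Harmonic Ritz vectors\<close>

text \<open>Symmetry lets both Ritz conditions be read on the same number: the inner product of \<open>A u\<close> and
  \<open>A w\<close> is both \<open>s\<close> times and \<open>t\<close> times that of \<open>u\<close> and \<open>A w\<close>.\<close>

lemma harmonic_ritz_vectors_orthogonal:
  fixes A :: "real ^ 'n ^ 'n"
  assumes "transpose A = A" "s \<noteq> t"
    and "orthogonal (A *v u - s *\<^sub>R u) (A *v w)"
    and "orthogonal (A *v w - t *\<^sub>R w) (A *v u)"
  shows "orthogonal (A *v u) (A *v w)"
proof -
  have "(A *v u) \<bullet> (A *v w) = s * (u \<bullet> (A *v w))"
    "(A *v u) \<bullet> (A *v w) = t * (u \<bullet> (A *v w))"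
    using assms(3,4) inner_symmetric_matrix[OF assms(1), of u w]
      inner_commute[of "A *v w"] inner_commute[of w]
    by (simp_all add: orthogonal_def inner_diff_left)
  then show ?thesis
    using assms(2) by (auto simp: orthogonal_def)
qed

text \<open>The dimension bound says that there are enough harmonic Ritz values for the images of their
  vectors to span the image of \<open>K\<close>. Orthogonality to such an image \<open>A u\<close> then follows by moving
  the factor \<open>A - t\<close> of \<open>r = (A - t) g\<close> over to \<open>u\<close>.\<close>

lemma orthogonal_image_if_all_harmonic_factors:
  fixes A :: "real ^ 'n ^ 'n"
  assumes sym: "transpose A = A" and inv: "invertible A"
    and T: "T \<subseteq> harmonic_ritz_values A K" "finite T" "dim K \<le> card T"
    and r: "\<And>t. t \<in> T \<Longrightarrow> \<exists>g\<in>K. r = A *v g - t *\<^sub>R g"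
    and w: "w \<in> K"
  shows "orthogonal r (A *v w)"
proof -
  have "\<forall>t\<in>T. \<exists>u. u \<in> K \<and> u \<noteq> 0 \<and>
      (\<forall>w\<in>K. orthogonal (A *v u - t *\<^sub>R u) (A *v w))"
    using T(1) by (auto simp: harmonic_ritz_values_def)
  then obtain u where u: "\<And>t. t \<in> T \<Longrightarrow> u t \<in> K" "\<And>t. t \<in> T \<Longrightarrow> u t \<noteq> 0"
    "\<And>t w. t \<in> T \<Longrightarrow> w \<in> K \<Longrightarrow>
      orthogonal (A *v u t - t *\<^sub>R u t) (A *v w)"
    by metis
  let ?U = "(\<lambda>t. A *v u t) ` T"
  have nz: "A *v u t \<noteq> 0" if "t \<in> T" for t
    using u(2)[OF that] inv by (metis inj_matrix_vector_mult injD matrix_vector_mult_0_right)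
  have orth: "orthogonal (A *v u s) (A *v u t)" if "s \<in> T" "t \<in> T" "s \<noteq> t" for s t
    using harmonic_ritz_vectors_orthogonal[OF sym] that u by blast
  have "inj_on (\<lambda>t. A *v u t) T"
  proof (rule inj_onI)
    fix s t assume st: "s \<in> T" "t \<in> T" "A *v u s = A *v u t"
    show "s = t"
    proof (rule ccontr)
      assume "s \<noteq> t"
      then have "orthogonal (A *v u s) (A *v u s)"
        using orth[of s t] st by simp
      then show False
        using nz[OF st(1)] by (simp add: orthogonal_self)
    qed
  qed
  then have "card ?U = card T"
    by (rule card_image)
  moreover have "independent ?U"
    using orth nz by (intro pairwise_orthogonal_independent) (auto simp: pairwise_def)
  moreover have "dim ((*v) A ` K) \<le> dim K"
    by (rule dim_image_le) (rule matrix_vector_mul_linear)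
  ultimately have "(*v) A ` K \<subseteq> span ?U"
    using T(3) u(1) by (intro card_ge_dim_independent) auto
  then have "A *v w \<in> span ?U"
    using w by blast
  moreover have "orthogonal r y" if y: "y \<in> ?U" for y
  proof -
    obtain t where t: "t \<in> T" "y = A *v u t"
      using y by blast
    obtain g where g: "g \<in> K" "r = A *v g - t *\<^sub>R g"
      using r t(1) by blast
    have "r \<bullet> (A *v u t) = (A *v u t - t *\<^sub>R u t) \<bullet> (A *v g)"
      using inner_symmetric_matrix[OF sym, of "u t" g]
        inner_commute[of "A *v g" "A *v u t"] inner_commute[of g "A *v u t"]
      by (simp add: g(2) inner_diff_left)
    also have "\<dots> = 0"
      using u(3)[OF t(1) g(1)] by (simp add: orthogonal_def)
    finally show ?thesis
      by (simp add: t(2) orthogonal_def)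
  qed
  ultimately show ?thesis
    by (rule orthogonal_to_span)
qed

section \<open>Krylov subspaces\<close>

lemma krylov_mono: "j \<le> k \<Longrightarrow> krylov A b j \<subseteq> krylov A b k"
  unfolding krylov_def by (rule span_mono) auto

lemma matrix_image_krylov: "x \<in> krylov A b k \<Longrightarrow> A *v x \<in> krylov A b (Suc k)"
proof -
  let ?G = "{((*v) A ^^ j) b |j. j < k}"
  assume "x \<in> krylov A b k"
  then have "A *v x \<in> span ((*v) A ` ?G)"
    by (simp add: krylov_def linear_span_image)
  moreover have "(*v) A ` ?G \<subseteq> {((*v) A ^^ j) b |j. j < Suc k}"
  proof clarsimp
    fix j assume "j < k"
    then show "\<exists>i. A *v ((*v) A ^^ j) b = ((*v) A ^^ i) b \<and> i < Suc k"
      by (intro exI[of _ "Suc j"]) simp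
  qed
  ultimately show ?thesis
    unfolding krylov_def using span_mono by blast
qed

lemma dim_krylov_le: "dim (krylov A b k) \<le> k"
proof -
  have G: "{((*v) A ^^ j) b |j. j < k} = (\<lambda>j. ((*v) A ^^ j) b) ` {..<k}"
    by auto
  have "dim (krylov A b k) \<le> card ((\<lambda>j. ((*v) A ^^ j) b) ` {..<k})"
    unfolding krylov_def G dim_span by (rule dim_le_card') simp
  also have "\<dots> \<le> k"
    using card_image_le[of "{..<k}" "\<lambda>j. ((*v) A ^^ j) b"] by simp
  finally show ?thesis .
qed

section \<open>Filtered eigenvector expansions\<close>

text \<open>
  If the columns of \<open>V\<close> are orthonormal eigenvectors of \<open>A\<close> with eigenvalues \<open>\<lambda>\<^sub>i\<close>, and
  \<open>f i = p(\<lambda>\<^sub>i)\<close>, this is \<open>p(A) b\<close> in the sense of the functional calculus. Taking the values \<open>f i\<close> as the argument lets polynomials in \<open>A\<close> be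
  multiplied and divided entry by entry.
\<close>

definition eigen_sum :: "real ^ 'n ^ 'n \<Rightarrow> real ^ 'n \<Rightarrow> ('n \<Rightarrow> real) \<Rightarrow> real ^ 'n" where
  "eigen_sum V b f = (\<Sum>i\<in>UNIV. (f i * (column i V \<bullet> b)) *\<^sub>R column i V)"

lemma eigen_sum_add: "eigen_sum V b (\<lambda>i. f i + g i) = eigen_sum V b f + eigen_sum V b g"
  by (simp add: eigen_sum_def sum.distrib algebra_simps)

lemma eigen_sum_diff: "eigen_sum V b (\<lambda>i. f i - g i) = eigen_sum V b f - eigen_sum V b g"
  by (simp add: eigen_sum_def sum_subtractf algebra_simps)

lemma eigen_sum_scale: "eigen_sum V b (\<lambda>i. c * f i) = c *\<^sub>R eigen_sum V b f"
  by (simp add: eigen_sum_def scaleR_sum_right mult.assoc)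

lemma eigen_sum_one:
  assumes "orthogonal_matrix V"
  shows "eigen_sum V b (\<lambda>i. 1) = b"
proof -
  have "V *v (transpose V *v b) = b"
    using assms
    by (simp add: orthogonal_matrix_def matrix_vector_mul_assoc del: transpose_matrix_vector)
  moreover have "(transpose V *v b) $ i = column i V \<bullet> b" for i
    by (simp add: matrix_vector_mult_def transpose_def column_def inner_vec_def
        del: transpose_matrix_vector)
  ultimately show ?thesis
    by (simp add: eigen_sum_def matrix_mult_sum scalar_mult_eq_scaleR
        del: transpose_matrix_vector)
qed

lemma diagonalized_column:
  fixes A V :: "real ^ 'n ^ 'n"
  assumes "orthogonal_matrix V" "A = V ** diag_matrix lam ** transpose V"
  shows "A *v column i V = lam $ i *\<^sub>R column i V"
proof -
  have "A ** V = V ** diag_matrix lam"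
    using assms by (simp add: orthogonal_matrix_def flip: matrix_mul_assoc)
  then have "(A ** V) $ m $ i = (V ** diag_matrix lam) $ m $ i" for m
    by simp
  then show ?thesis
    by (simp add: vec_eq_iff matrix_matrix_mult_def diag_matrix_def matrix_vector_mult_def
      column_def if_distrib mult.commute cong: if_cong)
qed

lemma matrix_eigen_sum:
  fixes A V :: "real ^ 'n ^ 'n"
  assumes "orthogonal_matrix V" "A = V ** diag_matrix lam ** transpose V"
  shows "A *v eigen_sum V b f = eigen_sum V b (\<lambda>i. lam $ i * f i)"
proof -
  have "A *v eigen_sum V b f = (\<Sum>i\<in>UNIV. (f i * (column i V \<bullet> b)) *\<^sub>R (A *v column i V))"
    unfolding eigen_sum_def
    by (simp add: linear_sum[OF matrix_vector_mul_linear] linear_cmul[OF matrix_vector_mul_linear])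
  then show ?thesis
    by (simp add: diagonalized_column[OF assms] eigen_sum_def mult_ac)
qed

lemma invertible_diagonalized:
  fixes A V :: "real ^ 'n ^ 'n"
  assumes V: "orthogonal_matrix V" and A: "A = V ** diag_matrix lam ** transpose V"
    and lam: "\<And>i. lam $ i \<noteq> 0"
  shows "invertible A"
proof -
  have "A *v eigen_sum V y (\<lambda>i. 1 / lam $ i) = y" for y
    using lam by (simp add: matrix_eigen_sum[OF V A] eigen_sum_one[OF V])
  then have "surj ((*v) A)"
    by (rule surjI)
  then show ?thesis
    by (simp add: matrix_right_invertible_surjective invertible_right_inverse)
qed

section \<open>The filter polynomial\<close>

text \<open>Why dividing by \<open>\<lambda>\<^sub>i\<close> does not lead out of the Krylov space. For
  \<open>q\<^sub>J(t) = (\<Prod>j\<in>J. 1 - t / \<theta>\<^sub>j)\<close>, enlarging \<open>J\<close> by \<open>j\<close> adds \<open>q\<^sub>J(t) / \<theta>\<^sub>j\<close> to \<open>(1 - q\<^sub>J(t)) / t\<close>.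
  Hence the approximate solution for \<open>J\<close> gains a multiple of its own residual, and the degree grows
  by one with each element of \<open>J\<close>.\<close>

lemma filtered_solution_in_krylov:
  fixes A V :: "real ^ 'n ^ 'n"
  assumes V: "orthogonal_matrix V" and A: "A = V ** diag_matrix lam ** transpose V"
    and lam: "\<And>i. lam $ i \<noteq> 0" and "finite J"
    and nz: "\<And>j. j \<in> J \<Longrightarrow> \<theta> j \<noteq> 0"
  shows "eigen_sum V b (\<lambda>i. (1 - (\<Prod>j\<in>J. (\<theta> j - lam $ i) / \<theta> j)) / lam $ i)
      \<in> krylov A b (card J)" (is "?x J \<in> _")
    and "eigen_sum V b (\<lambda>i. \<Prod>j\<in>J. (\<theta> j - lam $ i) / \<theta> j)
      \<in> krylov A b (Suc (card J))" (is "?r J \<in> _")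
proof -
  have res: "?r J = b - A *v ?x J" for J
    using lam by (simp add: matrix_eigen_sum[OF V A] eigen_sum_diff eigen_sum_one[OF V])
  have r_if_x: "?r J \<in> krylov A b (Suc (card J))" if "?x J \<in> krylov A b (card J)" for J
  proof -
    have "b \<in> krylov A b (Suc (card J))"
      unfolding krylov_def by (rule span_base) (auto intro!: exI[of _ 0])
    then show ?thesis
      unfolding res using matrix_image_krylov[OF that]
      by (simp add: krylov_def span_diff)
  qed
  show x: "?x J \<in> krylov A b (card J)"
    using \<open>finite J\<close> nz
  proof (induction J)
    case empty
    then show ?case
      by (simp add: eigen_sum_def krylov_def span_zero)
  next
    case (insert j J)
    have xJ: "?x J \<in> krylov A b (card J)"
      using insert by blast
    have "(1 - (\<Prod>j\<in>insert j J. (\<theta> j - lam $ i) / \<theta> j)) / lam $ i =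
        (1 - (\<Prod>j\<in>J. (\<theta> j - lam $ i) / \<theta> j)) / lam $ i +
        1 / \<theta> j * (\<Prod>j\<in>J. (\<theta> j - lam $ i) / \<theta> j)" for i
      using insert.hyps insert.prems[of j] lam[of i] by (simp add: field_simps)
    then have "?x (insert j J) = ?x J + (1 / \<theta> j) *\<^sub>R ?r J"
      by (simp only: eigen_sum_add eigen_sum_scale)
    moreover have "?x J \<in> krylov A b (Suc (card J))"
      using xJ krylov_mono[of "card J" "Suc (card J)"] by auto
    moreover have "?r J \<in> krylov A b (Suc (card J))"
      using xJ by (rule r_if_x)
    ultimately show ?case
      using insert.hyps by (simp add: krylov_def span_add span_scale)
  qed
  show "?r J \<in> krylov A b (Suc (card J))"
    by (rule r_if_x) (rule x)
qed

section \<open>The MINRES iterate\<close>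

theorem theorem3p1:
  fixes A V :: "real ^ ('n::{finite,linorder}) ^ ('n::{finite,linorder})"
    and lam b :: "real ^ ('n::{finite,linorder})"
    and k :: nat
    and \<theta> :: "nat \<Rightarrow> real"
  assumes "transpose A = A"
    and "orthogonal_matrix V"
    and "A = V ** diag_matrix lam ** transpose V"
    and "\<And>i j. i < j \<Longrightarrow> \<bar>lam $ i\<bar> > \<bar>lam $ j\<bar>"
    and "\<And>i. \<bar>lam $ i\<bar> > 0"
    and "\<And>i. column i V \<bullet> b \<noteq> 0"
    and "k \<ge> 1"
    and "harmonic_ritz_values A (krylov A b k) = \<theta> ` {1..k}"
    and "\<And>i j. 1 \<le> i \<Longrightarrow> i < j \<Longrightarrow> j \<le> k \<Longrightarrow> \<bar>\<theta> i\<bar> > \<bar>\<theta> j\<bar>"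
    and "\<bar>\<theta> k\<bar> > 0"
  shows "minres_iterate A b k =
    (\<Sum>i\<in>UNIV. ((1 - (\<Prod>j=1..k. (\<theta> j - lam $ i) / \<theta> j)) * ((column i V \<bullet> b) / lam $ i))
       *\<^sub>R column i V)"
proof -
  note V = assms(2) and A = assms(3)
  define r where "r J = eigen_sum V b (\<lambda>i. \<Prod>j\<in>J. (\<theta> j - lam $ i) / \<theta> j)" for J
  define x where "x = eigen_sum V b (\<lambda>i. (1 - (\<Prod>j=1..k. (\<theta> j - lam $ i) / \<theta> j)) / lam $ i)"
  have lam: "lam $ i \<noteq> 0" for i
    using assms(5)[of i] by auto
  have inv: "invertible A"
    using invertible_diagonalized[OF V A lam] .
  have inj: "inj_on \<theta> {1..k}"
    using assms(9) by (intro linorder_inj_onI) fastforce+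
  have nz: "\<theta> j \<noteq> 0" if "j \<in> {1..k}" for j
    using assms(9)[of j k] assms(10) that by (cases "j = k") force+
  have xK: "x \<in> krylov A b k"
    using filtered_solution_in_krylov(1)[OF V A lam, where J = "{1..k}" and \<theta> = \<theta>] nz
    by (simp add: x_def)
  have res: "b - A *v x = r {1..k}"
    using lam by (simp add: x_def r_def matrix_eigen_sum[OF V A] eigen_sum_diff eigen_sum_one[OF V])
  have factor: "\<exists>g\<in>krylov A b k. r {1..k} = A *v g - t *\<^sub>R g"
    if "t \<in> \<theta> ` {1..k}" for t
  proof -
    obtain j where j: "j \<in> {1..k}" "t = \<theta> j"
      using \<open>t \<in> \<theta> ` {1..k}\<close> by blast
    \<comment> \<open>Dropping the factor of \<open>j\<close> lowers the degree, and \<open>1 - s / \<theta>\<^sub>j = (s - \<theta>\<^sub>j) (-1 / \<theta>\<^sub>j)\<close>.\<close>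
    let ?J = "{1..k} - {j}"
    let ?g = "(- 1 / \<theta> j) *\<^sub>R r ?J"
    have "r ?J \<in> krylov A b (Suc (card ?J))"
      unfolding r_def using nz by (intro filtered_solution_in_krylov(2)[OF V A lam]) auto
    moreover have "Suc (card ?J) = k"
      using j(1) by auto
    ultimately have "r ?J \<in> krylov A b k"
      by (simp only:)
    then have "?g \<in> krylov A b k"
      unfolding krylov_def by (rule span_scale)
    moreover have "r {1..k} = A *v ?g - t *\<^sub>R ?g"
    proof -
      have "(\<Prod>l=1..k. (\<theta> l - lam $ i) / \<theta> l) =
          lam $ i * (- 1 / \<theta> j * (\<Prod>l\<in>?J. (\<theta> l - lam $ i) / \<theta> l)) -
          \<theta> j * (- 1 / \<theta> j * (\<Prod>l\<in>?J. (\<theta> l - lam $ i) / \<theta> l))" for i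
        unfolding prod.remove[OF finite_atLeastAtMost j(1)]
        using nz[OF j(1)] by (simp add: field_simps)
      then show ?thesis
        unfolding r_def j(2)
        by (simp only: matrix_eigen_sum[OF V A] eigen_sum_diff flip: eigen_sum_scale)
    qed
    ultimately show ?thesis
      by blast
  qed
  have "dim (krylov A b k) \<le> card (\<theta> ` {1..k})"
    using dim_krylov_le[of A b k] by (simp only: card_image[OF inj] card_atLeastAtMost diff_Suc_1)
  then have "orthogonal (b - A *v x) (A *v w)" if "w \<in> krylov A b k" for w
    unfolding res
    using orthogonal_image_if_all_harmonic_factors[OF assms(1) inv equalityD2[OF assms(8)]]
      factor that by blast
  then have "minres_iterate A b k = x"
    using minres_iterate_eqI[OF inv xK] by blast
  then show ?thesis
    by (simp add: x_def eigen_sum_def)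
qed

end
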